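(* Let $\mathcal{H}$ be a complex separable Hilbert space, let $A,B$ be bounded linear operators on $\mathcal{H}$, and put $\mathcal{M}=\operatorname{ran}A$, $\mathcal{N}=\operatorname{ran}B$ and $\Gamma=(AA^*+BB^* )^{1/2}$. Then, as linear relations on $\mathcal{H}$, $$P_{\mathcal{M},\mathcal{N}}=(\Gamma^{-1}AA^* )^*\Gamma^{-1}\ \hat{\dotplus}\ (\{0\}\times(\mathcal{M}\cap\mathcal{N})).$$
   Context: A linear relation on $\mathcal{H}$ is a linear subspace of $\mathcal{H}\times\mathcal{H}$; operators are identified with their graphs. $T^{-1}=\{(y,x):(x,y)\in T\}$ (so $\Gamma^{-1}=\{(\Gamma x,x):x\in\mathcal{H}\}$ is a relation), $RT=\{(x,y):(x,z)\in T,(z,y)\in R\text{ for some }z\}$, and the adjoint of a relation is $T^*=\{(x,y):\langle g,x\rangle=\langle f,y\rangle\ \forall(f,g)\in T\}$. $T\,\hat{\dotplus}\,S$ is the sum of $T$ and $S$ as subspaces of $\mathcal{H}\times\mathcal{H}$, with $T\cap S=\{0\}$. For subspaces $\mathcal{M},\mathcal{N}$, $P_{\mathcal{M},\mathcal{N}}=\{(m+n,m):m\in\mathcal{M},n\in\mathcal{N}\}$. *)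

theory Defs
  imports "HOL-Analysis.Analysis"
begin

section \<open>Complex Hilbert spaces\<close>

text \<open>The inner product is linear in its first argument. The real scalar multiplication, the norm
  and completeness come from the class \<open>banach\<close>; positive definiteness of the inner product
  follows from \<open>norm_eq_sqrt_cinner\<close>.\<close>

class chilbert_space = banach +
  fixes scaleC :: "complex \<Rightarrow> 'a \<Rightarrow> 'a" (infixr \<open>*\<^sub>C\<close> 75)
    and cinner :: "'a \<Rightarrow> 'a \<Rightarrow> complex"
  assumes scaleC_add_right: "c *\<^sub>C (x + y) = c *\<^sub>C x + c *\<^sub>C y"
    and scaleC_add_left: "(c + d) *\<^sub>C x = c *\<^sub>C x + d *\<^sub>C x"
    and scaleC_scaleC: "c *\<^sub>C (d *\<^sub>C x) = (c * d) *\<^sub>C x"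
    and scaleR_scaleC: "r *\<^sub>R x = complex_of_real r *\<^sub>C x"
    and cinner_commute: "cinner x y = cnj (cinner y x)"
    and cinner_add_left: "cinner (x + y) z = cinner x z + cinner y z"
    and cinner_scaleC_left: "cinner (c *\<^sub>C x) y = c * cinner x y"
    and norm_eq_sqrt_cinner: "norm x = sqrt (Re (cinner x x))"

instantiation complex :: chilbert_space
begin

definition scaleC_complex :: "complex \<Rightarrow> complex \<Rightarrow> complex"
  where "scaleC_complex c x = c * x"

definition cinner_complex :: "complex \<Rightarrow> complex \<Rightarrow> complex"
  where "cinner_complex x y = x * cnj y"

instance
  by standard
    (simp_all add: scaleC_complex_def cinner_complex_def algebra_simps scaleR_conv_of_real
      cmod_def power2_eq_square)

end

definition bounded_clinear :: "('a::chilbert_space \<Rightarrow> 'a) \<Rightarrow> bool"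
  where "bounded_clinear A \<longleftrightarrow> bounded_linear A \<and> (\<forall>c x. A (c *\<^sub>C x) = c *\<^sub>C A x)"


section \<open>Linear relations\<close>

definition linear_relation :: "('a::chilbert_space \<times> 'a) set \<Rightarrow> bool"
  where "linear_relation T \<longleftrightarrow>
    0 \<in> T \<and> (\<forall>s\<in>T. \<forall>t\<in>T. s + t \<in> T) \<and>
    (\<forall>c x y. (x, y) \<in> T \<longrightarrow> (c *\<^sub>C x, c *\<^sub>C y) \<in> T)"

definition op_graph :: "('a \<Rightarrow> 'a) \<Rightarrow> ('a \<times> 'a) set"
  where "op_graph A = {(x, A x) | x. True}"

text \<open>\<open>rel_mult R T\<close> is \<open>RT\<close>, that is, \<open>T\<close> is applied first; the inverse of a
  relation is \<open>converse\<close>.\<close>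

definition rel_mult :: "('a \<times> 'a) set \<Rightarrow> ('a \<times> 'a) set \<Rightarrow> ('a \<times> 'a) set"
  where "rel_mult R T = {(x, y). \<exists>z. (x, z) \<in> T \<and> (z, y) \<in> R}"

definition rel_adjoint :: "('a::chilbert_space \<times> 'a) set \<Rightarrow> ('a \<times> 'a) set"
  where "rel_adjoint T = {(x, y). \<forall>(f, g)\<in>T. cinner g x = cinner f y}"

text \<open>\<open>+\<close> on sets is the elementwise (Minkowski) sum.\<close>

definition is_direct_sum ::
  "('a::chilbert_space \<times> 'a) set \<Rightarrow> ('a \<times> 'a) set \<Rightarrow> ('a \<times> 'a) set \<Rightarrow> bool"
  where "is_direct_sum R T S \<longleftrightarrow>
    linear_relation T \<and> linear_relation S \<and> T \<inter> S = {0} \<and> R = T + S"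

definition rel_projection :: "'a::chilbert_space set \<Rightarrow> 'a set \<Rightarrow> ('a \<times> 'a) set"
  where "rel_projection M N = {(m + n, m) | m n. m \<in> M \<and> n \<in> N}"


section \<open>Adjoint and square root of bounded operators\<close>

text \<open>For bounded linear \<open>A\<close> the adjoint of the graph of \<open>A\<close> is the graph of a unique
  everywhere defined operator.\<close>

definition op_adjoint :: "('a::chilbert_space \<Rightarrow> 'a) \<Rightarrow> 'a \<Rightarrow> 'a"
  where "op_adjoint A = (THE A'. op_graph A' = rel_adjoint (op_graph A))"

definition positive_op :: "('a::chilbert_space \<Rightarrow> 'a) \<Rightarrow> bool"
  where "positive_op T \<longleftrightarrow> bounded_clinear T \<and> (\<forall>x. cinner (T x) x \<in> \<real>\<^sub>\<ge>\<^sub>0)"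

text \<open>Meaningful for positive \<open>T\<close>, which has exactly one positive square root.\<close>

definition op_sqrt :: "('a::chilbert_space \<Rightarrow> 'a) \<Rightarrow> 'a \<Rightarrow> 'a"
  where "op_sqrt T = (THE S. positive_op S \<and> S \<circ> S = T)"

end

(* Douglas factorization gives bounded X, Y with A = \<Gamma> X and B = \<Gamma> Y, and X X* + Y Y* = 1 on
   (ker \<Gamma>)\<^sup>\<bottom>. The adjoint of the relation \<Gamma>\<^sup>-\<^sup>1 A A* is then the operator A X* with domain
   (ker \<Gamma>)\<^sup>\<bottom>, so the first summand consists of the pairs (\<Gamma> u, A X* u) with u orthogonal to
   ker \<Gamma>. Since \<Gamma> u = A X* u + B Y* u, these lie in the projection relation; conversely
   (A a + B b, A a) differs from the pair of u = X a + Y b by an element of 0 \<times> (ran A \<inter> ran B). *)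

theory Submission
  imports Defs
begin

section \<open>Elementary inner product facts\<close>

lemma scaleC_zero_right [simp]: "c *\<^sub>C (0::'a::chilbert_space) = 0"
  using scaleC_add_right[of c 0 "0::'a"] by simp

lemma cinner_add_right: "cinner x (y + z) = cinner x y + cinner (x::'a::chilbert_space) z"
  by (metis cinner_add_left cinner_commute complex_cnj_add)

lemma cinner_scaleC_right: "cinner x (c *\<^sub>C y) = cnj c * cinner (x::'a::chilbert_space) y"
  by (metis cinner_scaleC_left cinner_commute complex_cnj_mult)

lemma cinner_scaleR_left: "cinner (r *\<^sub>R x) y = of_real r * cinner (x::'a::chilbert_space) y"
  by (simp add: scaleR_scaleC cinner_scaleC_left)

lemma cinner_scaleR_right: "cinner x (r *\<^sub>R y) = of_real r * cinner (x::'a::chilbert_space) y"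
  by (simp add: scaleR_scaleC cinner_scaleC_right)

lemma cinner_zero_left [simp]: "cinner 0 (y::'a::chilbert_space) = 0"
  using cinner_add_left[of 0 0 y] by simp

lemma cinner_zero_right [simp]: "cinner (y::'a::chilbert_space) 0 = 0"
  using cinner_add_right[of y 0 0] by simp

lemma cinner_minus_left: "cinner (- x) y = - cinner (x::'a::chilbert_space) y"
  using cinner_add_left[of x "-x" y] by (simp add: eq_neg_iff_add_eq_0 add.commute)

lemma cinner_minus_right: "cinner x (- y) = - cinner (x::'a::chilbert_space) y"
  using cinner_add_right[of x y "-y"] by (simp add: eq_neg_iff_add_eq_0 add.commute)

lemma cinner_diff_left: "cinner (x - y) z = cinner x z - cinner (y::'a::chilbert_space) z"
  using cinner_add_left[of x "- y" z] by (simp add: cinner_minus_left)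

lemma cinner_diff_right: "cinner x (y - z) = cinner x y - cinner (x::'a::chilbert_space) z"
  using cinner_add_right[of x y "- z"] by (simp add: cinner_minus_right)

lemmas cinner_simps = cinner_add_left cinner_add_right cinner_diff_left cinner_diff_right
  cinner_minus_left cinner_minus_right cinner_scaleR_left cinner_scaleR_right
  cinner_scaleC_left cinner_scaleC_right

lemma norm_sq_cinner: "(norm x)\<^sup>2 = Re (cinner x (x::'a::chilbert_space))"
proof -
  have "0 \<le> sqrt (Re (cinner x x))"
    by (metis norm_eq_sqrt_cinner norm_ge_zero)
  then show ?thesis by (simp add: norm_eq_sqrt_cinner)
qed

lemma cinner_self: "cinner x x = of_real ((norm (x::'a::chilbert_space))\<^sup>2)"
proof (rule complex_eqI)
  show "Im (cinner x x) = Im (of_real ((norm x)\<^sup>2))"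
    using arg_cong[OF cinner_commute[of x x], of Im] by simp
qed (simp add: norm_sq_cinner)

lemma cinner_self_eq_zero: "cinner x x = 0 \<longleftrightarrow> x = (0::'a::chilbert_space)"
  by (simp add: cinner_self)

lemma cinner_eq_zero_commute: "cinner x y = 0 \<longleftrightarrow> cinner y (x::'a::chilbert_space) = 0"
  by (subst cinner_commute) simp

lemma cinner_left_cancel:
  assumes "\<And>x. cinner x y = cinner x (z::'a::chilbert_space)"
  shows "y = z"
  using assms[of "y - z"] cinner_self_eq_zero[of "y - z"] by (simp add: cinner_diff_right)

lemma Re_cinner_commute: "Re (cinner x y) = Re (cinner y (x::'a::chilbert_space))"
  by (metis cinner_commute cnj.sel(1))

lemma discriminant_nonpos:
  fixes a b c :: real
  assumes "\<And>t. 0 \<le> a + 2 * t * b + t\<^sup>2 * c" "0 \<le> c"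
  shows "b\<^sup>2 \<le> a * c"
proof (cases "c = 0")
  case True
  have "b = 0"
  proof (rule ccontr)
    assume "b \<noteq> 0"
    with assms(1)[of "- (a + 1) / (2 * b)"] True show False by (simp add: field_simps)
  qed
  with True show ?thesis by simp
next
  case False
  have "0 \<le> c * (a + 2 * (- b / c) * b + (- b / c)\<^sup>2 * c)"
    using assms(2) assms(1)[of "- b / c"] by (rule mult_nonneg_nonneg)
  also have "\<dots> = a * c - b\<^sup>2"
    using False by (simp add: field_simps power2_eq_square)
  finally show ?thesis by simp
qed

lemma Re_cinner_le: "Re (cinner x y) \<le> norm x * norm (y::'a::chilbert_space)"
proof -
  have "0 \<le> (norm x)\<^sup>2 + 2 * t * Re (cinner x y) + t\<^sup>2 * (norm y)\<^sup>2" for t :: real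
  proof -
    have "0 \<le> (norm (x + t *\<^sub>R y))\<^sup>2" by simp
    then show ?thesis
      unfolding norm_sq_cinner
      using Re_cinner_commute[of x y] by (simp add: cinner_simps power2_eq_square algebra_simps)
  qed
  then have "(Re (cinner x y))\<^sup>2 \<le> (norm x)\<^sup>2 * (norm y)\<^sup>2"
    by (rule discriminant_nonpos) simp
  then show ?thesis
    by (metis power_mult_distrib abs_le_square_iff abs_ge_self abs_norm_cancel abs_mult order_trans)
qed

lemma norm_scaleC: "norm (c *\<^sub>C x) = cmod c * norm (x::'a::chilbert_space)"
proof -
  have "cinner (c *\<^sub>C x) (c *\<^sub>C x) = (c * cnj c) * cinner x x"
    by (simp add: cinner_scaleC_left cinner_scaleC_right)
  also have "\<dots> = of_real ((cmod c * norm x)\<^sup>2)"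
    by (simp only: cinner_self of_real_mult power_mult_distrib of_real_power flip: complex_norm_square)
  finally have "(norm (c *\<^sub>C x))\<^sup>2 = (cmod c * norm x)\<^sup>2"
    by (simp only: norm_sq_cinner Re_complex_of_real)
  then show ?thesis by simp
qed

lemma norm_cinner_le: "cmod (cinner x y) \<le> norm x * norm (y::'a::chilbert_space)"
proof (cases "cinner x y = 0")
  case False
  define z where "z = cinner x y"
  define c where "c = cnj z / of_real (cmod z)"
  have "cmod c = 1" using False by (simp add: c_def z_def norm_divide)
  have "c * z = z * cnj z / of_real (cmod z)" by (simp add: c_def)
  also have "\<dots> = of_real (cmod z)"
    using False by (simp only: flip: complex_norm_square) (simp add: power2_eq_square z_def)
  finally have "c * cinner x y = of_real (cmod (cinner x y))" unfolding z_def .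
  then have "cmod (cinner x y) = Re (cinner (c *\<^sub>C x) y)"
    by (simp add: cinner_scaleC_left)
  also have "\<dots> \<le> norm x * norm y"
    using Re_cinner_le[of "c *\<^sub>C x" y] \<open>cmod c = 1\<close> by (simp add: norm_scaleC)
  finally show ?thesis .
qed simp

lemma bounded_linear_cinner_left: "bounded_linear (\<lambda>x. cinner x (y::'a::chilbert_space))"
  by (rule bounded_linear_intro[of _ "norm y"])
    (simp_all add: cinner_add_left cinner_scaleR_left norm_cinner_le scaleR_conv_of_real)

lemma bounded_linear_cinner_right: "bounded_linear (\<lambda>y. cinner (x::'a::chilbert_space) y)"
  by (rule bounded_linear_intro[of _ "norm x"])
    (simp_all add: cinner_add_right cinner_scaleR_right scaleR_conv_of_real,
      metis norm_cinner_le mult.commute)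

lemma bounded_linear_scaleC: "bounded_linear (\<lambda>x::'a::chilbert_space. c *\<^sub>C x)"
  by (rule bounded_linear_intro[of _ "cmod c"])
    (simp_all add: scaleC_add_right scaleR_scaleC scaleC_scaleC norm_scaleC mult.commute)

lemma scaleC_diff_right: "c *\<^sub>C (x - y) = c *\<^sub>C x - c *\<^sub>C (y::'a::chilbert_space)"
  by (rule linear_simps(2)[OF bounded_linear_scaleC])

lemma bounded_clinearD:
  assumes "bounded_clinear A"
  shows "bounded_linear A" "A (x + y) = A x + A y" "A (x - y) = A x - A y"
    "A (c *\<^sub>C x) = c *\<^sub>C A x" "A (r *\<^sub>R x) = r *\<^sub>R A x" "A 0 = 0"
proof -
  show bl: "bounded_linear A" and "A (c *\<^sub>C x) = c *\<^sub>C A x"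
    using assms by (simp_all add: bounded_clinear_def)
  show "A (x + y) = A x + A y" "A (x - y) = A x - A y" "A (r *\<^sub>R x) = r *\<^sub>R A x" "A 0 = 0"
    using bl by (rule linear_simps)+
qed

lemma range_bounded_clinear:
  assumes "bounded_clinear A"
  shows "0 \<in> range A" "x \<in> range A \<Longrightarrow> y \<in> range A \<Longrightarrow> x + y \<in> range A"
    "x \<in> range A \<Longrightarrow> c *\<^sub>C x \<in> range A"
proof -
  note A = bounded_clinearD[OF assms]
  show "0 \<in> range A" using rangeI[of A 0] by (simp only: A)
  show "x + y \<in> range A" if "x \<in> range A" "y \<in> range A"
    using that by (auto simp flip: A(2))
  show "c *\<^sub>C x \<in> range A" if "x \<in> range A"
    using that by (auto simp flip: A(4))
qed

section \<open>Riesz representation and Douglas factorization\<close>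

lemma quadratic_nonneg_imp_zero:
  fixes b c :: real
  assumes "\<And>t. 0 \<le> 2 * t * b + t\<^sup>2 * c" "0 \<le> c"
  shows "b = 0"
  using discriminant_nonpos[of 0 b c] assms by simp

text \<open>The representing vector is the limit of \<open>S x\<close> along a minimizing sequence of
  \<open>\<parallel>S x\<parallel>\<^sup>2 - 2 Re (\<phi> x)\<close>.\<close>

lemma riesz_on_range:
  fixes S :: "'a::chilbert_space \<Rightarrow> 'a" and \<phi> :: "'a \<Rightarrow> complex"
  assumes S_add: "\<And>x y. S (x + y) = S x + S y" and S_scale: "\<And>c x. S (c *\<^sub>C x) = c *\<^sub>C S x"
    and \<phi>_add: "\<And>x y. \<phi> (x + y) = \<phi> x + \<phi> y" and \<phi>_scale: "\<And>c x. \<phi> (c *\<^sub>C x) = c * \<phi> x"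
    and bound: "\<And>x. cmod (\<phi> x) \<le> C * norm (S x)" and "0 \<le> C"
  obtains u where "\<And>x. \<phi> x = cinner (S x) u" "u \<in> closure (range S)" "norm u \<le> C"
proof -
  have S_scaleR: "S (r *\<^sub>R x) = r *\<^sub>R S x" and \<phi>_scaleR: "\<phi> (r *\<^sub>R x) = of_real r * \<phi> x" for r x
    by (simp_all add: scaleR_scaleC S_scale \<phi>_scale)
  define J where "J x = (norm (S x))\<^sup>2 - 2 * Re (\<phi> x)" for x
  have J_lower: "- C\<^sup>2 \<le> J x" for x
  proof -
    have "Re (\<phi> x) \<le> C * norm (S x)"
      using bound[of x] complex_Re_le_cmod[of "\<phi> x"] by linarith
    moreover have "0 \<le> (norm (S x) - C)\<^sup>2" by simp
    ultimately show ?thesis by (simp add: J_def power2_diff algebra_simps)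
  qed
  define m where "m = Inf (range J)"
  have bdd: "bdd_below (range J)" using J_lower by (auto simp: bdd_below_def)
  have m_le: "m \<le> J x" for x unfolding m_def by (rule cInf_lower[OF _ bdd]) simp
  have "\<exists>x. J x < m + 1 / real (Suc n)" for n
  proof -
    have "Inf (range J) < m + 1 / real (Suc n)" by (simp add: m_def)
    from cInf_lessD[OF _ this] show ?thesis by auto
  qed
  then obtain x where x: "\<And>n. J (x n) < m + 1 / real (Suc n)" by metis
  have J_expand: "J (y + t *\<^sub>R h) = J y + 2 * t * (Re (cinner (S h) (S y)) - Re (\<phi> h)) + t\<^sup>2 * (norm (S h))\<^sup>2"
    for y h t
    unfolding J_def norm_sq_cinner using Re_cinner_commute[of "S h" "S y"]
    by (simp add: S_add \<phi>_add S_scaleR \<phi>_scaleR cinner_simps algebra_simps power2_eq_square)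
  have J_mid: "(norm (S y - S z))\<^sup>2 = 2 * J y + 2 * J z - 4 * J ((1/2) *\<^sub>R (y + z))" for y z
    using Re_cinner_commute[of "S y" "S z"]
    by (simp add: J_def S_add \<phi>_add S_scaleR \<phi>_scaleR norm_sq_cinner cinner_simps algebra_simps)
  have close: "(norm (S (x n) - S (x k)))\<^sup>2 \<le> 2 / real (Suc n) + 2 / real (Suc k)" for n k
    using J_mid[of "x n" "x k"] x[of n] x[of k] m_le[of "(1/2) *\<^sub>R (x n + x k)"] by linarith
  have "Cauchy (\<lambda>n. S (x n))"
  proof (rule CauchyI)
    fix e :: real assume "0 < e"
    then obtain K where K: "inverse (real (Suc K)) < e\<^sup>2 / 4"
      using reals_Archimedean[of "e\<^sup>2 / 4"] by auto
    show "\<exists>K. \<forall>n\<ge>K. \<forall>k\<ge>K. norm (S (x n) - S (x k)) < e"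
    proof (intro exI[of _ K] allI impI)
      fix n k assume "K \<le> n" "K \<le> k"
      then have "1 / real (Suc n) \<le> inverse (real (Suc K))" "1 / real (Suc k) \<le> inverse (real (Suc K))"
        by (simp_all add: field_simps)
      with close[of n k] K have "(norm (S (x n) - S (x k)))\<^sup>2 < e\<^sup>2" by simp
      then show "norm (S (x n) - S (x k)) < e"
        using \<open>0 < e\<close> by (simp add: power_less_imp_less_base)
    qed
  qed
  then obtain u where u: "(\<lambda>n. S (x n)) \<longlonglongrightarrow> u"
    using Cauchy_convergent convergent_def by blast
  have lim_cinner: "(\<lambda>n. cinner (S (x n)) v) \<longlonglongrightarrow> cinner u v" for v
    by (rule bounded_linear.tendsto[OF bounded_linear_cinner_left u])
  have Re_eq: "Re (cinner u (S h)) = Re (\<phi> h)" for h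
  proof -
    have "0 \<le> 2 * t * (Re (cinner u (S h)) - Re (\<phi> h)) + t\<^sup>2 * (norm (S h))\<^sup>2" for t
    proof (rule LIMSEQ_le_const)
      show "(\<lambda>n. 1 / real (Suc n) + (2 * t * (Re (cinner (S (x n)) (S h)) - Re (\<phi> h)) + t\<^sup>2 * (norm (S h))\<^sup>2))
        \<longlonglongrightarrow> 2 * t * (Re (cinner u (S h)) - Re (\<phi> h)) + t\<^sup>2 * (norm (S h))\<^sup>2"
        by (rule tendsto_eq_rhs, (rule tendsto_intros lim_cinner
            LIMSEQ_inverse_real_of_nat[unfolded inverse_eq_divide])+) simp
      show "\<exists>N. \<forall>n\<ge>N. 0 \<le> 1 / real (Suc n) + (2 * t * (Re (cinner (S (x n)) (S h)) - Re (\<phi> h)) + t\<^sup>2 * (norm (S h))\<^sup>2)"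
      proof (intro exI allI impI)
        fix n
        show "0 \<le> 1 / real (Suc n) + (2 * t * (Re (cinner (S (x n)) (S h)) - Re (\<phi> h)) + t\<^sup>2 * (norm (S h))\<^sup>2)"
          using m_le[of "x n + t *\<^sub>R h"] x[of n] Re_cinner_commute[of "S h" "S (x n)"]
          unfolding J_expand by simp
      qed
    qed
    from quadratic_nonneg_imp_zero[OF this] show ?thesis by simp
  qed
  have rep: "\<phi> h = cinner (S h) u" for h
  proof (rule complex_eqI)
    show "Re (\<phi> h) = Re (cinner (S h) u)"
      using Re_eq[of h] Re_cinner_commute by metis
    show "Im (\<phi> h) = Im (cinner (S h) u)"
      using Re_eq[of "\<i> *\<^sub>C h"] Re_cinner_commute[of u "\<i> *\<^sub>C S h"]
      by (simp add: S_scale \<phi>_scale cinner_scaleC_left)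
  qed
  have "(norm u)\<^sup>2 \<le> C * norm u"
  proof (rule LIMSEQ_le)
    show "(\<lambda>n. Re (cinner (S (x n)) u)) \<longlonglongrightarrow> (norm u)\<^sup>2"
      unfolding norm_sq_cinner by (intro tendsto_Re lim_cinner)
    show "(\<lambda>n. C * norm (S (x n))) \<longlonglongrightarrow> C * norm u"
      by (intro tendsto_intros u)
    show "\<exists>N. \<forall>n\<ge>N. Re (cinner (S (x n)) u) \<le> C * norm (S (x n))"
      using bound rep complex_Re_le_cmod order_trans by metis
  qed
  then have "norm u \<le> C"
    using \<open>0 \<le> C\<close> by (cases "norm u = 0") (auto simp: power2_eq_square)
  moreover have "u \<in> closure (range S)"
    unfolding closure_sequential by (intro exI[of _ "\<lambda>n. S (x n)"]) (simp add: u)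
  ultimately show ?thesis using that[OF rep] by simp
qed

lemma douglas_factorization:
  fixes F S :: "'a::chilbert_space \<Rightarrow> 'a"
  assumes F: "bounded_clinear F" and S: "bounded_clinear S"
    and bound: "\<And>x. norm (F x) \<le> K * norm (S x)" and "0 \<le> K"
  obtains X where "bounded_clinear X" "\<And>x a. cinner (F x) a = cinner (S x) (X a)"
    "\<And>a v. (\<And>x. cinner (S x) v = 0) \<Longrightarrow> cinner (X a) v = 0"
proof -
  note F' = bounded_clinearD[OF F] and S' = bounded_clinearD[OF S]
  have "\<exists>u. (\<forall>x. cinner (F x) a = cinner (S x) u) \<and> u \<in> closure (range S) \<and> norm u \<le> norm a * K" for a
  proof -
    have "cmod (cinner (F x) a) \<le> (norm a * K) * norm (S x)" for x
      using order_trans[OF norm_cinner_le mult_right_mono[OF bound norm_ge_zero]]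
      by (simp add: mult.commute mult.left_commute)
    then obtain u where "\<And>x. cinner (F x) a = cinner (S x) u" "u \<in> closure (range S)" "norm u \<le> norm a * K"
      using riesz_on_range[of S "\<lambda>x. cinner (F x) a" "norm a * K"] \<open>0 \<le> K\<close>
      by (auto simp: F' S' cinner_simps)
    then show ?thesis by blast
  qed
  then obtain X where X: "\<And>x a. cinner (F x) a = cinner (S x) (X a)"
    and X_closure: "\<And>a. X a \<in> closure (range S)" and X_norm: "\<And>a. norm (X a) \<le> norm a * K"
    by metis
  have X_orth: "cinner (X a) v = 0" if "\<And>x. cinner (S x) v = 0" for a v
  proof -
    have "closed {w. cinner w v = 0}"
      by (intro closed_Collect_eq continuous_on_const
          linear_continuous_on bounded_linear_cinner_left)
    then have "closure (range S) \<subseteq> {w. cinner w v = 0}"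
      using that by (intro closure_minimal) auto
    with X_closure show ?thesis by blast
  qed
  have X_add: "X (a + b) = X a + X b" for a b
  proof -
    let ?d = "X (a + b) - (X a + X b)"
    have "cinner (S x) ?d = 0" for x
      by (simp add: cinner_simps flip: X)
    then have "cinner ?d ?d = 0"
      using X_orth[of ?d] by (simp add: cinner_diff_left cinner_add_left)
    then show ?thesis by (simp add: cinner_self_eq_zero)
  qed
  have X_scale: "X (c *\<^sub>C a) = c *\<^sub>C X a" for c a
  proof -
    let ?d = "X (c *\<^sub>C a) - c *\<^sub>C X a"
    have "cinner (S x) ?d = 0" for x
      by (simp add: cinner_simps flip: X)
    then have "cinner ?d ?d = 0"
      using X_orth[of ?d] by (simp add: cinner_diff_left cinner_scaleC_left)
    then show ?thesis by (simp add: cinner_self_eq_zero)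
  qed
  have "bounded_linear X"
    by (rule bounded_linear_intro[of _ K]) (simp_all add: X_add X_scale X_norm scaleR_scaleC)
  then have "bounded_clinear X" by (simp add: bounded_clinear_def X_scale)
  then show ?thesis using X X_orth by (rule that)
qed

lemma op_adjoint_eqI:
  assumes "\<And>x y. cinner (A x) y = cinner x (A' y)"
  shows "op_adjoint A = A'"
proof -
  have "(\<forall>f. cinner (A f) x = cinner f y) \<longleftrightarrow> y = A' x" for x y
    by (metis assms cinner_left_cancel)
  then have graph: "op_graph A' = rel_adjoint (op_graph A)"
    by (fastforce simp: op_graph_def rel_adjoint_def)
  show ?thesis unfolding op_adjoint_def
  proof (rule the_equality, rule graph)
    fix B assume "op_graph B = rel_adjoint (op_graph A)"
    with graph have "op_graph B = op_graph A'" by simp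
    then show "B = A'" by (auto simp: op_graph_def fun_eq_iff set_eq_iff)
  qed
qed

lemma op_adjoint:
  assumes "bounded_clinear A"
  shows bounded_clinear_op_adjoint: "bounded_clinear (op_adjoint A)"
    and cinner_op_adjoint: "cinner (A x) y = cinner x (op_adjoint A y)"
    and cinner_op_adjoint': "cinner (op_adjoint A x) y = cinner x (A y)"
proof -
  obtain K where "0 < K" and K: "\<And>x. norm (A x) \<le> norm x * K"
    using bounded_linear.pos_bounded[OF bounded_clinearD(1)[OF assms]] by blast
  have id: "bounded_clinear (\<lambda>x::'a. x)" by (simp add: bounded_clinear_def bounded_linear_ident)
  obtain A' where A': "bounded_clinear A'" "\<And>x y. cinner (A x) y = cinner x (A' y)"
    using douglas_factorization[OF assms id, of K] K \<open>0 < K\<close> by (auto simp: mult.commute)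
  note eq = op_adjoint_eqI[OF A'(2)]
  show "bounded_clinear (op_adjoint A)" and adj: "cinner (A x) y = cinner x (op_adjoint A y)" for x y
    using A' by (simp_all add: eq)
  show "cinner (op_adjoint A x) y = cinner x (A y)"
    by (metis adj cinner_commute)
qed

section \<open>Positive operators and their square roots\<close>

lemma positive_op_iff:
  "positive_op T \<longleftrightarrow> bounded_clinear T \<and> (\<forall>x y. cinner (T x) y = cinner x (T y)) \<and>
    (\<forall>x. 0 \<le> Re (cinner (T x) x))" (is "?L \<longleftrightarrow> ?R")
proof
  assume ?L
  then have T: "bounded_clinear T" and Re: "0 \<le> Re (cinner (T x) x)"
    and Im: "Im (cinner (T x) x) = 0" for x
    by (auto simp: positive_op_def complex_nonneg_Reals_iff)
  note T' = bounded_clinearD[OF T]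
  have Im_eq: "Im (cinner (T x) y) = Im (cinner x (T y))" for x y
    using Im[of "x + y"] Im[of x] Im[of y] arg_cong[OF cinner_commute[of x "T y"], of Im]
    by (simp add: T' cinner_simps)
  have "cinner (T x) y = cinner x (T y)" for x y
    using Im_eq[of x y] Im_eq[of "\<i> *\<^sub>C x" y]
    by (simp add: T' cinner_simps complex_eq_iff)
  with T Re show ?R by blast
next
  assume R: ?R
  then have "cinner (T x) x = cnj (cinner (T x) x)" for x
    using cinner_commute[of "T x" x] by simp
  then have "Im (cinner (T x) x) = 0" for x
    by (metis Reals_cnj_iff complex_is_Real_iff)
  with R show ?L unfolding positive_op_def complex_nonneg_Reals_iff by blast
qed

lemma positive_opD:
  assumes "positive_op T"
  shows "bounded_clinear T" "cinner (T x) y = cinner x (T y)" "0 \<le> Re (cinner (T x) x)"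
  using assms unfolding positive_op_iff by blast+

lemma positive_opI:
  assumes "bounded_clinear T" "\<And>x y. cinner (T x) y = cinner x (T y)"
    "\<And>x. 0 \<le> Re (cinner (T x) x)"
  shows "positive_op T"
  using assms unfolding positive_op_iff by blast

lemma positive_op_Cauchy_Schwarz:
  assumes "positive_op P"
  shows "(Re (cinner (P x) y))\<^sup>2 \<le> Re (cinner (P x) x) * Re (cinner (P y) y)"
proof (rule discriminant_nonpos)
  have P: "bounded_clinear P" and sym: "\<And>x y. cinner (P x) y = cinner x (P y)"
    and pos: "\<And>x. 0 \<le> Re (cinner (P x) x)"
    using assms by (auto simp: positive_op_iff)
  show "0 \<le> Re (cinner (P y) y)" by (rule pos)
  fix t
  have "Re (cinner (P y) x) = Re (cinner (P x) y)"
    using Re_cinner_commute[of "P y" x] by (simp add: sym)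
  then show "0 \<le> Re (cinner (P x) x) + 2 * t * Re (cinner (P x) y) + t\<^sup>2 * Re (cinner (P y) y)"
    using pos[of "x + t *\<^sub>R y"]
    by (simp add: bounded_clinearD[OF P] cinner_simps power2_eq_square algebra_simps)
qed

lemma positive_op_eq_zero:
  assumes "positive_op P" "Re (cinner (P x) x) = 0"
  shows "P x = 0"
  using positive_op_Cauchy_Schwarz[OF assms(1), of x "P x"] assms(2)
  by (simp flip: norm_sq_cinner)

lemma positive_op_norm_le:
  assumes "positive_op P" "\<And>x. Re (cinner (P x) x) \<le> (norm x)\<^sup>2"
  shows "norm (P x) \<le> norm x"
proof (cases "P x = 0")
  case False
  have "(norm (P x))\<^sup>2 * (norm (P x))\<^sup>2 \<le> Re (cinner (P x) x) * Re (cinner (P (P x)) (P x))"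
    using positive_op_Cauchy_Schwarz[OF assms(1), of x "P x"]
    unfolding norm_sq_cinner power2_eq_square[of "Re _"] .
  also have "\<dots> \<le> (norm x)\<^sup>2 * (norm (P x))\<^sup>2"
    using assms(2)[of x] assms(2)[of "P x"] assms(1)[unfolded positive_op_iff]
    by (intro mult_mono zero_le_power2) blast+
  finally have "(norm (P x))\<^sup>2 \<le> (norm x)\<^sup>2"
    by (rule mult_right_le_imp_le) (use False in simp)
  then show ?thesis by (rule power2_le_imp_le) simp
qed simp

text \<open>Solves \<open>(1 - Y)\<^sup>2 = 1 - R\<close> by iterating \<open>y \<mapsto> (R + y\<^sup>2) / 2\<close> from \<open>0\<close>. The increments are
  dominated in norm by those of the same iteration for the scalar \<open>1\<close> in place of \<open>R\<close>. The closed
  invariants \<open>P\<close> carry symmetry and commutation relations over to the limit.\<close>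

lemma blinfun_square_root_iteration:
  fixes R :: "'a::banach \<Rightarrow>\<^sub>L 'a"
  assumes R: "norm R \<le> 1"
  obtains Y where "2 *\<^sub>R Y = R + (Y o\<^sub>L Y)"
    "\<And>P. closed P \<Longrightarrow> 0 \<in> P \<Longrightarrow> (\<And>y. y \<in> P \<Longrightarrow> (1/2) *\<^sub>R (R + (y o\<^sub>L y)) \<in> P) \<Longrightarrow> Y \<in> P"
proof -
  interpret comp: bounded_bilinear "(o\<^sub>L) :: ('a \<Rightarrow>\<^sub>L 'a) \<Rightarrow> _"
    by (rule bounded_bilinear_blinfun_compose)
  define y where "y = rec_nat 0 (\<lambda>_ y. (1/2) *\<^sub>R (R + (y o\<^sub>L y)))"
  have y0: "y 0 = 0" and ySuc: "y (Suc n) = (1/2) *\<^sub>R (R + (y n o\<^sub>L y n))" for n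
    by (simp_all add: y_def)
  define a :: "nat \<Rightarrow> real" where "a = rec_nat 0 (\<lambda>_ a. (1 + a\<^sup>2) / 2)"
  have a0: "a 0 = 0" and aSuc: "a (Suc n) = (1 + (a n)\<^sup>2) / 2" for n
    by (simp_all add: a_def)
  have a_range: "0 \<le> a n \<and> a n \<le> 1" for n
    by (induction n) (auto simp: a0 aSuc power_le_one)
  have a_mono: "a n \<le> a (Suc n)" for n
    using zero_le_power2[of "1 - a n"] by (simp add: aSuc power2_diff)
  have y_norm: "norm (y n) \<le> a n" for n
  proof (induction n)
    case (Suc n)
    have "norm (R + (y n o\<^sub>L y n)) \<le> 1 + norm (y n) * norm (y n)"
      using R norm_blinfun_compose[of "y n" "y n"] norm_triangle_ineq[of R "y n o\<^sub>L y n"] by linarith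
    also have "\<dots> \<le> 1 + a n * a n" using Suc a_range[of n] by (intro add_mono mult_mono) auto
    finally show ?case by (simp add: ySuc aSuc power2_eq_square)
  qed (simp add: y0 a0)
  have commute: "C o\<^sub>L y n = y n o\<^sub>L C" if "C o\<^sub>L R = R o\<^sub>L C" for C n
  proof (induction n)
    case (Suc n)
    then have "C (y n x) = y n (C x)" for x
      by (metis blinfun_apply_blinfun_compose)
    then have "C o\<^sub>L (y n o\<^sub>L y n) = (y n o\<^sub>L y n) o\<^sub>L C"
      by (intro blinfun_eqI) simp
    with that show ?case by (simp add: ySuc comp.scaleR_right comp.scaleR_left comp.add_left comp.add_right)
  qed (simp add: y0 comp.zero_left comp.zero_right)
  have y_commute: "y m o\<^sub>L y n = y n o\<^sub>L y m" for m n
    by (rule commute) (rule commute[symmetric, OF refl])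
  have increment: "norm (y (Suc n) - y n) \<le> a (Suc n) - a n" for n
  proof (induction n)
    case 0
    show ?case using R by (simp add: y0 ySuc a0 aSuc comp.zero_left)
  next
    case (Suc n)
    have "y (Suc (Suc n)) - y (Suc n) = (1/2) *\<^sub>R ((y (Suc n) o\<^sub>L y (Suc n)) - (y n o\<^sub>L y n))"
      using ySuc[of n] ySuc[of "Suc n"]
      by (metis add_diff_cancel_left scaleR_diff_right)
    also have "\<dots> = (1/2) *\<^sub>R ((y (Suc n) - y n) o\<^sub>L (y (Suc n) + y n))"
      by (simp add: comp.add_right comp.diff_left y_commute[of n "Suc n"])
    also have "norm \<dots> \<le> (1/2) * (norm (y (Suc n) - y n) * norm (y (Suc n) + y n))"
      by (simp add: norm_blinfun_compose)
    also have "\<dots> \<le> (1/2) * ((a (Suc n) - a n) * (a (Suc n) + a n))"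
      using Suc a_mono[of n] y_norm[of n] y_norm[of "Suc n"] norm_triangle_ineq[of "y (Suc n)" "y n"]
      by (intro mult_left_mono mult_mono) auto
    also have "\<dots> = a (Suc (Suc n)) - a (Suc n)"
    proof -
      have "a (Suc (Suc n)) - a (Suc n) = (1 + (a (Suc n))\<^sup>2) / 2 - (1 + (a n)\<^sup>2) / 2"
        by (simp only: aSuc)
      then show ?thesis by (simp add: power2_eq_square field_simps)
    qed
    finally show ?case .
  qed
  have "incseq a" using a_mono by (rule incseq_SucI)
  then obtain L where "a \<longlonglongrightarrow> L"
    using incseq_convergent[of a 1] a_range by blast
  then have "summable (\<lambda>n. a (Suc n) - a n)" by (rule telescope_summable)
  then have "summable (\<lambda>n. y (Suc n) - y n)"
    by (rule summable_comparison_test') (rule increment)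
  then have "(\<lambda>n. \<Sum>i<n. y (Suc i) - y i) \<longlonglongrightarrow> (\<Sum>i. y (Suc i) - y i)"
    by (rule summable_LIMSEQ)
  then obtain Y where Y: "y \<longlonglongrightarrow> Y"
    by (auto simp: sum_lessThan_telescope y0)
  show ?thesis
  proof (rule that)
    have "(\<lambda>n. 2 *\<^sub>R y (Suc n)) \<longlonglongrightarrow> 2 *\<^sub>R Y"
      by (intro tendsto_intros LIMSEQ_Suc Y)
    moreover have "(\<lambda>n. 2 *\<^sub>R y (Suc n)) \<longlonglongrightarrow> R + (Y o\<^sub>L Y)"
      unfolding ySuc by (auto intro!: tendsto_intros comp.tendsto Y)
    ultimately show "2 *\<^sub>R Y = R + (Y o\<^sub>L Y)" by (rule LIMSEQ_unique)
    fix P assume P: "closed P" "0 \<in> P" "\<And>y. y \<in> P \<Longrightarrow> (1/2) *\<^sub>R (R + (y o\<^sub>L y)) \<in> P"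
    have "y n \<in> P" for n by (induction n) (use P in \<open>simp_all add: y0 ySuc\<close>)
    with P(1) Y show "Y \<in> P" by (metis closed_sequentially)
  qed
qed


lemma contractive_positive_sqrt:
  fixes T :: "'a::chilbert_space \<Rightarrow> 'a"
  assumes T: "positive_op T" and T_le: "\<And>x. Re (cinner (T x) x) \<le> (norm x)\<^sup>2"
  obtains S where "positive_op S" "\<And>x. S (S x) = T x"
    "\<And>C x. bounded_linear C \<Longrightarrow> (\<And>y. C (T y) = T (C y)) \<Longrightarrow> C (S x) = S (C x)"
proof -
  have clin: "bounded_clinear T" and sym: "\<And>x y. cinner (T x) y = cinner x (T y)"
    and pos: "\<And>x. 0 \<le> Re (cinner (T x) x)"
    using T by (auto simp: positive_op_iff)
  note T' = bounded_clinearD[OF clin]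
  define R where "R x = x - T x" for x
  have R_lin: "bounded_linear R"
    unfolding R_def by (intro bounded_linear_sub bounded_linear_ident T'(1))
  have "bounded_clinear R"
    unfolding bounded_clinear_def using R_lin by (simp add: R_def T' scaleC_diff_right)
  then have "positive_op R"
    by (rule positive_opI) (use T_le in \<open>simp_all add: R_def cinner_simps sym flip: norm_sq_cinner\<close>)
  then have "norm (R x) \<le> norm x" for x
    by (rule positive_op_norm_le) (use pos in \<open>simp add: R_def cinner_diff_left flip: norm_sq_cinner\<close>)
  moreover define Rb where "Rb = Blinfun R"
  moreover have Rb: "blinfun_apply Rb x = R x" for x
    unfolding Rb_def by (simp add: bounded_linear_Blinfun_apply R_lin)
  ultimately have "norm Rb \<le> 1" by (intro norm_blinfun_bound) auto
  then obtain Y where Y: "2 *\<^sub>R Y = Rb + (Y o\<^sub>L Y)"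
    and Y_inv: "\<And>P. closed P \<Longrightarrow> 0 \<in> P \<Longrightarrow> (\<And>y. y \<in> P \<Longrightarrow> (1/2) *\<^sub>R (Rb + (y o\<^sub>L y)) \<in> P) \<Longrightarrow> Y \<in> P"
    using blinfun_square_root_iteration[of Rb] by blast
  have "Y \<in> {y. norm y \<le> 1}"
  proof (rule Y_inv)
    fix y :: "'a \<Rightarrow>\<^sub>L 'a" assume "y \<in> {y. norm y \<le> 1}"
    then have "norm (y o\<^sub>L y) \<le> 1"
      using norm_blinfun_compose[of y y] mult_le_one[of "norm y" "norm y"] by simp
    then show "(1/2) *\<^sub>R (Rb + (y o\<^sub>L y)) \<in> {y. norm y \<le> 1}"
      using \<open>norm Rb \<le> 1\<close> norm_triangle_ineq[of Rb "y o\<^sub>L y"] by simp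
  qed (auto intro!: closed_Collect_le continuous_intros)
  then have Y_norm: "norm (Y x) \<le> norm x" for x
    using norm_blinfun[of Y x] mult_right_mono[of "norm Y" 1 "norm x"] by simp
  have "Y \<in> {y. \<forall>x z. cinner (blinfun_apply y x) z = cinner x (blinfun_apply y z)}"
  proof (rule Y_inv)
    show "closed {y. \<forall>x z. cinner (blinfun_apply y x) (z::'a) = cinner x (blinfun_apply y z)}"
      by (intro closed_Collect_all closed_Collect_eq
          bounded_linear.continuous_on[OF bounded_linear_cinner_left]
          bounded_linear.continuous_on[OF bounded_linear_cinner_right]
          bounded_linear.continuous_on[OF blinfun.bounded_linear_left] continuous_on_id)
  qed (simp_all add: blinfun.add_left blinfun.scaleR_left Rb R_def cinner_simps sym)
  then have Y_sym: "cinner (Y x) z = cinner x (Y z)" for x z by simp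
  have Y_commute: "C (Y x) = Y (C x)"
    if C: "bounded_linear C" and CT: "\<And>x. C (T x) = T (C x)" for C x
  proof -
    have Cb: "blinfun_apply (Blinfun C) x = C x" for x
      by (simp add: bounded_linear_Blinfun_apply C)
    have "Y \<in> {y. \<forall>x. C (blinfun_apply y x) = blinfun_apply y (C x)}"
    proof (rule Y_inv)
      show "closed {y. \<forall>x. C (blinfun_apply y x) = blinfun_apply y (C x)}"
        by (intro closed_Collect_all closed_Collect_eq bounded_linear.continuous_on[OF C]
            bounded_linear.continuous_on[OF blinfun.bounded_linear_left] continuous_on_id)
    qed (simp_all add: blinfun.add_left blinfun.scaleR_left Rb R_def CT linear_simps[OF C])
    then show ?thesis by simp
  qed
  define S where "S x = x - Y x" for x
  show ?thesis
  proof (rule that)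
    have "bounded_linear S"
      unfolding S_def by (intro bounded_linear_sub bounded_linear_ident blinfun.bounded_linear_right)
    moreover have "c *\<^sub>C Y x = Y (c *\<^sub>C x)" for c x
      by (rule Y_commute) (simp_all add: bounded_linear_scaleC T')
    ultimately have "bounded_clinear S"
      by (simp add: bounded_clinear_def S_def scaleC_diff_right)
    moreover have "Re (cinner (Y x) x) \<le> (norm x)\<^sup>2" for x
      using Re_cinner_le[of "Y x" x] mult_right_mono[OF Y_norm[of x], of "norm x"]
      by (simp add: power2_eq_square)
    ultimately show "positive_op S"
      by (intro positive_opI) (simp_all add: S_def cinner_diff_left cinner_diff_right Y_sym flip: norm_sq_cinner)
    fix x
    have "2 *\<^sub>R Y x = R x + Y (Y x)"
      using arg_cong[OF Y, of "\<lambda>y. blinfun_apply y x"] by (simp add: blinfun.add_left blinfun.scaleR_left Rb)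
    then show "S (S x) = T x"
      by (simp add: S_def R_def blinfun.diff_right scaleR_2 algebra_simps)
  next
    fix C x assume "bounded_linear C" "\<And>x. C (T x) = T (C x)"
    then show "C (S x) = S (C x)" by (simp add: S_def linear_simps Y_commute)
  qed
qed

lemma bounded_clinear_scaleR:
  assumes "bounded_clinear A"
  shows "bounded_clinear (\<lambda>x. r *\<^sub>R A x)"
  using bounded_linear_compose[OF bounded_linear_scaleR_right bounded_clinearD(1)[OF assms]]
  by (simp add: bounded_clinear_def bounded_clinearD[OF assms])
    (simp add: scaleR_scaleC scaleC_scaleC mult.commute)

lemma positive_op_scaleR: "positive_op T \<Longrightarrow> 0 \<le> r \<Longrightarrow> positive_op (\<lambda>x. r *\<^sub>R T x)"
  by (rule positive_opI)
    (simp_all add: bounded_clinear_scaleR cinner_scaleR_left cinner_scaleR_right positive_opD(1,3),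
      simp add: positive_opD(2))

lemma positive_sqrt_exists:
  fixes T :: "'a::chilbert_space \<Rightarrow> 'a"
  assumes T: "positive_op T"
  obtains S where "positive_op S" "\<And>x. S (S x) = T x"
    "\<And>C x. bounded_linear C \<Longrightarrow> (\<And>y. C (T y) = T (C y)) \<Longrightarrow> C (S x) = S (C x)"
proof -
  have "bounded_linear T" using T by (simp add: positive_op_def bounded_clinear_def)
  then obtain K where K: "0 < K" "\<And>x. norm (T x) \<le> norm x * K"
    using bounded_linear.pos_bounded by blast
  have "positive_op (\<lambda>x. (1/K) *\<^sub>R T x)"
    using T \<open>0 < K\<close> by (simp add: positive_op_scaleR)
  moreover have "Re (cinner ((1/K) *\<^sub>R T x) x) \<le> (norm x)\<^sup>2" for x
  proof -
    have "Re (cinner (T x) x) \<le> K * (norm x)\<^sup>2"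
      using Re_cinner_le[of "T x" x] mult_right_mono[OF K(2)[of x], of "norm x"]
      by (simp add: power2_eq_square algebra_simps)
    with \<open>0 < K\<close> show ?thesis by (simp add: cinner_scaleR_left field_simps)
  qed
  ultimately obtain S where S: "positive_op S" "\<And>x. S (S x) = (1/K) *\<^sub>R T x"
    "\<And>C x. bounded_linear C \<Longrightarrow> (\<And>y. C ((1/K) *\<^sub>R T y) = (1/K) *\<^sub>R T (C y)) \<Longrightarrow> C (S x) = S (C x)"
    using contractive_positive_sqrt by blast
  have "bounded_linear S" using S(1) by (simp add: positive_op_def bounded_clinear_def)
  show ?thesis
  proof (rule that)
    show "positive_op (\<lambda>x. sqrt K *\<^sub>R S x)"
      using S(1) \<open>0 < K\<close> by (simp add: positive_op_scaleR)
    show "sqrt K *\<^sub>R S (sqrt K *\<^sub>R S x) = T x" for x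
      using \<open>0 < K\<close> S(2)[of x] by (simp add: linear_simps[OF \<open>bounded_linear S\<close>])
    show "C (sqrt K *\<^sub>R S x) = sqrt K *\<^sub>R S (C x)"
      if "bounded_linear C" "\<And>x. C (T x) = T (C x)" for C x
      using S(3)[OF that(1)] that by (simp add: linear_simps)
  qed
qed

lemma positive_sqrt_unique:
  fixes T :: "'a::chilbert_space \<Rightarrow> 'a"
  assumes S: "positive_op S" "\<And>x. S (S x) = T x"
    and S': "positive_op S'" "\<And>x. S' (S' x) = T x"
    and commute: "\<And>x. S' (S x) = S (S' x)"
  shows "S = S'"
proof
  fix x
  note lin = S(1)[unfolded positive_op_iff, THEN conjunct1, THEN bounded_clinearD(3)]
    S'(1)[unfolded positive_op_iff, THEN conjunct1, THEN bounded_clinearD(3)]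
  define y where "y = S x - S' x"
  have "S y + S' y = 0" by (simp add: y_def lin S S' commute)
  then have "Re (cinner (S y) y) + Re (cinner (S' y) y) = 0"
    by (metis cinner_add_left cinner_zero_left plus_complex.sel(1) zero_complex.sel(1))
  moreover have "0 \<le> Re (cinner (S y) y)" "0 \<le> Re (cinner (S' y) y)"
    by (rule positive_opD(3), rule S S')+
  ultimately have "S y = 0" "S' y = 0"
    using positive_op_eq_zero[OF S(1), of y] positive_op_eq_zero[OF S'(1), of y] by simp_all
  moreover have "cinner y y = cinner x (S y) - cinner x (S' y)"
    by (subst (1) y_def) (simp add: cinner_diff_left positive_opD(2)[OF S(1)] positive_opD(2)[OF S'(1)])
  ultimately have "cinner y y = 0" by simp
  then show "S x = S' x" by (simp add: cinner_self_eq_zero y_def)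
qed

lemma op_sqrt:
  fixes T :: "'a::chilbert_space \<Rightarrow> 'a"
  assumes T: "positive_op T"
  shows positive_op_sqrt: "positive_op (op_sqrt T)"
    and op_sqrt_op_sqrt: "op_sqrt T (op_sqrt T x) = T x"
proof -
  obtain S where S: "positive_op S" "\<And>x. S (S x) = T x"
    "\<And>C x. bounded_linear C \<Longrightarrow> (\<And>x. C (T x) = T (C x)) \<Longrightarrow> C (S x) = S (C x)"
    using positive_sqrt_exists[OF T] by metis
  have "\<exists>!S. positive_op S \<and> S \<circ> S = T"
  proof (rule ex1I[of _ S])
    show "positive_op S \<and> S \<circ> S = T" using S by auto
    fix S' assume "positive_op S' \<and> S' \<circ> S' = T"
    then have S': "positive_op S'" "\<And>x. S' (S' x) = T x" by auto
    have "S' (S x) = S (S' x)" for x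
      by (rule S(3)) (use S' in \<open>simp_all add: positive_op_def bounded_clinear_def flip: S'(2)\<close>)
    with S S' show "S' = S" by (metis positive_sqrt_unique)
  qed
  from theI'[OF this] show "positive_op (op_sqrt T)" "op_sqrt T (op_sqrt T x) = T x"
    unfolding op_sqrt_def by (auto simp: fun_eq_iff)
qed

section \<open>The decomposition\<close>

theorem corollary5p4:
  fixes A B \<Gamma> :: "'a::chilbert_space \<Rightarrow> 'a" and M N :: "'a set"
  assumes "separable_space (euclidean :: 'a topology)"
    and "bounded_clinear A" and "bounded_clinear B"
    and "M = range A" and "N = range B"
    and "\<Gamma> = op_sqrt (\<lambda>x. A (op_adjoint A x) + B (op_adjoint B x))"
  shows "is_direct_sum (rel_projection M N)
    (rel_mult (rel_adjoint (rel_mult (converse (op_graph \<Gamma>)) (op_graph (A \<circ> op_adjoint A))))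
      (converse (op_graph \<Gamma>)))
    ({0} \<times> (M \<inter> N))"
proof -
  note A = bounded_clinearD[OF assms(2)] and B = bounded_clinearD[OF assms(3)]
  note A_clin = bounded_clinear_op_adjoint[OF assms(2)] and B_clin = bounded_clinear_op_adjoint[OF assms(3)]
  note A_adj = cinner_op_adjoint[OF assms(2)] cinner_op_adjoint'[OF assms(2)]
    and B_adj = cinner_op_adjoint[OF assms(3)] cinner_op_adjoint'[OF assms(3)]
  let ?T = "\<lambda>x. A (op_adjoint A x) + B (op_adjoint B x)"
  have "bounded_linear ?T"
    by (intro bounded_linear_add bounded_linear_compose[OF A(1)] bounded_linear_compose[OF B(1)]
        bounded_clinearD(1)[OF A_clin] bounded_clinearD(1)[OF B_clin])
  then have "bounded_clinear ?T"
    by (simp add: bounded_clinear_def A B bounded_clinearD[OF A_clin] bounded_clinearD[OF B_clin]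
        scaleC_add_right)
  then have "positive_op ?T"
  proof (rule positive_opI)
    show "cinner (?T x) y = cinner x (?T y)" for x y
      by (simp add: cinner_add_left cinner_add_right A_adj B_adj)
    have "Re (cinner (?T x) x) = (norm (op_adjoint A x))\<^sup>2 + (norm (op_adjoint B x))\<^sup>2" for x
      by (simp only: cinner_add_left A_adj(1) B_adj(1) plus_complex.sel norm_sq_cinner)
    then show "0 \<le> Re (cinner (?T x) x)" for x by simp
  qed
  from positive_op_sqrt[OF this] op_sqrt_op_sqrt[OF this]
  have \<Gamma>_clin: "bounded_clinear \<Gamma>" and \<Gamma>_sym: "\<And>x y. cinner (\<Gamma> x) y = cinner x (\<Gamma> y)"
    and \<Gamma>_sq: "\<And>x. \<Gamma> (\<Gamma> x) = ?T x"
    by (auto simp: positive_op_iff assms(6))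
  note \<Gamma> = bounded_clinearD[OF \<Gamma>_clin]
  have norm_\<Gamma>: "(norm (\<Gamma> x))\<^sup>2 = (norm (op_adjoint A x))\<^sup>2 + (norm (op_adjoint B x))\<^sup>2" for x
    by (simp add: norm_sq_cinner \<Gamma>_sym \<Gamma>_sq cinner_add_right A_adj B_adj)
  have le: "norm (op_adjoint A x) \<le> 1 * norm (\<Gamma> x)" "norm (op_adjoint B x) \<le> 1 * norm (\<Gamma> x)" for x
    using norm_\<Gamma>[of x] by (simp_all add: power2_le_imp_le)
  obtain X where X_clin: "bounded_clinear X"
    and X: "\<And>x a. cinner (op_adjoint A x) a = cinner (\<Gamma> x) (X a)"
    and X_ker: "\<And>a k. (\<And>x. cinner (\<Gamma> x) k = 0) \<Longrightarrow> cinner (X a) k = 0"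
    using douglas_factorization[OF A_clin \<Gamma>_clin le(1)] by auto
  obtain Y where Y_clin: "bounded_clinear Y"
    and Y: "\<And>x a. cinner (op_adjoint B x) a = cinner (\<Gamma> x) (Y a)"
    and Y_ker: "\<And>a k. (\<And>x. cinner (\<Gamma> x) k = 0) \<Longrightarrow> cinner (Y a) k = 0"
    using douglas_factorization[OF B_clin \<Gamma>_clin le(2)] by auto
  have \<Gamma>X: "\<Gamma> (X a) = A a" for a
    by (rule cinner_left_cancel) (metis \<Gamma>_sym X A_adj(2))
  have \<Gamma>Y: "\<Gamma> (Y a) = B a" for a
    by (rule cinner_left_cancel) (metis \<Gamma>_sym Y B_adj(2))
  define Xa where "Xa = op_adjoint X"
  define Ya where "Ya = op_adjoint Y"
  have X_adj: "cinner (X x) y = cinner x (Xa y)" "cinner (Xa x) y = cinner x (X y)"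
    and Y_adj: "cinner (Y x) y = cinner x (Ya y)" "cinner (Ya x) y = cinner x (Y y)" for x y
    by (simp_all add: Xa_def Ya_def cinner_op_adjoint cinner_op_adjoint' X_clin Y_clin)
  have Xa_clin: "bounded_clinear Xa"
    by (simp add: Xa_def bounded_clinear_op_adjoint X_clin)
  have Xa_\<Gamma>: "Xa (\<Gamma> x) = op_adjoint A x" for x
    by (rule cinner_left_cancel) (metis X_adj(1) \<Gamma>_sym \<Gamma>X A_adj(1))
  have Ya_\<Gamma>: "Ya (\<Gamma> x) = op_adjoint B x" for x
    by (rule cinner_left_cancel) (metis Y_adj(1) \<Gamma>_sym \<Gamma>Y B_adj(1))
  define D where "D = {u. \<forall>k. \<Gamma> k = 0 \<longrightarrow> cinner u k = 0}"
  have X_D: "X a \<in> D" and Y_D: "Y a \<in> D" for a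
    by (simp_all add: D_def X_ker Y_ker \<Gamma>_sym)
  have D_0: "0 \<in> D" and D_add: "u \<in> D \<Longrightarrow> v \<in> D \<Longrightarrow> u + v \<in> D"
    and D_scale: "u \<in> D \<Longrightarrow> c *\<^sub>C u \<in> D" for u v c
    by (simp_all add: D_def cinner_simps)
  text \<open>\<open>\<Gamma> (X X\<^sup>* + Y Y\<^sup>* - 1) \<Gamma> = 0\<close>, so \<open>X X\<^sup>* + Y Y\<^sup>* - 1\<close> maps \<open>ran \<Gamma>\<close> into \<open>ker \<Gamma>\<close>; taking
    adjoints, \<open>\<Gamma> (X X\<^sup>* + Y Y\<^sup>* - 1)\<close> vanishes on \<open>(ker \<Gamma>)\<^sup>\<bottom>\<close>.\<close>
  have decomp: "\<Gamma> u = A (Xa u) + B (Ya u)" if "u \<in> D" for u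
  proof (rule cinner_left_cancel)
    fix x
    have "\<Gamma> (X (Xa (\<Gamma> x)) + Y (Ya (\<Gamma> x)) - \<Gamma> x) = 0"
      by (simp add: \<Gamma> \<Gamma>X \<Gamma>Y Xa_\<Gamma> Ya_\<Gamma> \<Gamma>_sq)
    with that have "cinner u (X (Xa (\<Gamma> x)) + Y (Ya (\<Gamma> x)) - \<Gamma> x) = 0"
      by (simp add: D_def)
    moreover have "cinner u (X (Xa (\<Gamma> x))) = cinner (A (Xa u)) x"
      "cinner u (Y (Ya (\<Gamma> x))) = cinner (B (Ya u)) x"
      by (metis X_adj \<Gamma>_sym \<Gamma>X, metis Y_adj \<Gamma>_sym \<Gamma>Y)
    ultimately have "cinner (A (Xa u) + B (Ya u)) x = cinner (\<Gamma> u) x"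
      by (simp add: cinner_add_right cinner_add_left cinner_diff_right \<Gamma>_sym)
    then show "cinner x (\<Gamma> u) = cinner x (A (Xa u) + B (Ya u))"
      by (metis cinner_commute)
  qed
  let ?R = "rel_mult (converse (op_graph \<Gamma>)) (op_graph (A \<circ> op_adjoint A))"
  let ?L = "rel_mult (rel_adjoint ?R) (converse (op_graph \<Gamma>))"
  have R: "?R = {(f, g). \<Gamma> g = A (op_adjoint A f)}"
    by (auto simp: rel_mult_def op_graph_def)
  have adj_R: "(u, v) \<in> rel_adjoint ?R \<longleftrightarrow> u \<in> D \<and> v = A (Xa u)" for u v
  proof
    assume "(u, v) \<in> rel_adjoint ?R"
    then have *: "\<And>f g. \<Gamma> g = A (op_adjoint A f) \<Longrightarrow> cinner g u = cinner f v"
      by (auto simp: rel_adjoint_def R)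
    have "cinner k u = 0" if "\<Gamma> k = 0" for k
      using *[of k 0] that by (simp add: A bounded_clinearD[OF A_clin])
    then have "u \<in> D" by (simp add: D_def cinner_eq_zero_commute[of u])
    moreover have "A (Xa u) = v"
    proof (rule cinner_left_cancel)
      show "cinner f (A (Xa u)) = cinner f v" for f
        using *[of "X (op_adjoint A f)" f] by (simp add: \<Gamma>X X_adj A_adj)
    qed
    ultimately show "u \<in> D \<and> v = A (Xa u)" by simp
  next
    assume uv: "u \<in> D \<and> v = A (Xa u)"
    have "cinner g u = cinner f v" if "\<Gamma> g = A (op_adjoint A f)" for f g
    proof -
      have "\<Gamma> (g - X (op_adjoint A f)) = 0" using that by (simp add: \<Gamma> \<Gamma>X)
      with uv have "cinner u (g - X (op_adjoint A f)) = 0" by (simp add: D_def)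
      then have "cinner (g - X (op_adjoint A f)) u = 0"
        by (simp only: cinner_eq_zero_commute[of u])
      then show ?thesis using uv by (simp add: cinner_diff_left X_adj A_adj)
    qed
    then show "(u, v) \<in> rel_adjoint ?R" by (auto simp: rel_adjoint_def R)
  qed
  have L: "?L = {(\<Gamma> u, A (Xa u)) | u. u \<in> D}"
    by (auto simp: rel_mult_def[of "rel_adjoint _"] adj_R) (auto simp: op_graph_def)
  have lin_L: "linear_relation ?L"
    unfolding linear_relation_def
  proof (intro conjI ballI allI impI)
    show "0 \<in> ?L" unfolding L using D_0
      by (auto intro!: exI[of _ 0] simp: \<Gamma> A bounded_clinearD[OF Xa_clin] zero_prod_def)
    fix s t assume "s \<in> ?L" "t \<in> ?L"
    then obtain u v where "u \<in> D" "v \<in> D" "s = (\<Gamma> u, A (Xa u))" "t = (\<Gamma> v, A (Xa v))"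
      unfolding L by blast
    then show "s + t \<in> ?L" unfolding L
      by (auto intro!: exI[of _ "u + v"] D_add simp: \<Gamma> A bounded_clinearD[OF Xa_clin])
  next
    fix c x y assume "(x, y) \<in> ?L"
    then obtain u where "u \<in> D" "x = \<Gamma> u" "y = A (Xa u)"
      unfolding L by blast
    then show "(c *\<^sub>C x, c *\<^sub>C y) \<in> ?L" unfolding L
      by (auto intro!: exI[of _ "c *\<^sub>C u"] D_scale simp: \<Gamma> A bounded_clinearD[OF Xa_clin])
  qed
  have lin_MN: "linear_relation ({0} \<times> (M \<inter> N))"
    unfolding linear_relation_def assms(4,5)
    by (auto simp: zero_prod_def range_bounded_clinear assms(2,3))
  have disjoint: "?L \<inter> {0} \<times> (M \<inter> N) = {0}"
  proof
    show "?L \<inter> {0} \<times> (M \<inter> N) \<subseteq> {0}"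
    proof
      fix p assume p: "p \<in> ?L \<inter> {0} \<times> (M \<inter> N)"
      then obtain u where u: "u \<in> D" "p = (\<Gamma> u, A (Xa u))" unfolding L by blast
      with p have "u = 0" by (auto simp: D_def cinner_self_eq_zero)
      with u show "p \<in> {0}" by (simp add: \<Gamma> A bounded_clinearD[OF Xa_clin] zero_prod_def)
    qed
    show "{0} \<subseteq> ?L \<inter> {0} \<times> (M \<inter> N)"
      using lin_L lin_MN unfolding linear_relation_def by blast
  qed
  have sum: "rel_projection M N = ?L + {0} \<times> (M \<inter> N)"
  proof
    show "rel_projection M N \<subseteq> ?L + {0} \<times> (M \<inter> N)"
    proof
      fix p assume "p \<in> rel_projection M N"
      then obtain a b where p: "p = (A a + B b, A a)"
        by (auto simp: rel_projection_def assms)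
      define u where "u = X a + Y b"
      have "u \<in> D" by (simp add: u_def D_add X_D Y_D)
      have \<Gamma>u: "\<Gamma> u = A a + B b" by (simp add: u_def \<Gamma> \<Gamma>X \<Gamma>Y)
      have "A a - A (Xa u) = B (Ya u - b)"
        using decomp[OF \<open>u \<in> D\<close>] \<Gamma>u by (simp add: B algebra_simps)
      moreover have "A a - A (Xa u) = A (a - Xa u)" by (simp add: A)
      ultimately have "A a - A (Xa u) \<in> M \<inter> N" unfolding assms by (metis IntI rangeI)
      then have "(\<Gamma> u, A (Xa u)) + (0, A a - A (Xa u)) \<in> ?L + {0} \<times> (M \<inter> N)"
        using \<open>u \<in> D\<close> by (intro set_plus_intro) (auto simp: L)
      then show "p \<in> ?L + {0} \<times> (M \<inter> N)" by (simp add: p \<Gamma>u)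
    qed
    show "?L + {0} \<times> (M \<inter> N) \<subseteq> rel_projection M N"
    proof
      fix p assume "p \<in> ?L + {0} \<times> (M \<inter> N)"
      then obtain u m where u: "u \<in> D" and m: "m \<in> M \<inter> N" and p: "p = (\<Gamma> u, A (Xa u) + m)"
        by (auto simp: L elim!: set_plus_elim)
      obtain a b where a: "m = A a" and b: "m = B b" using m unfolding assms(4,5) by blast
      have "p = (A (Xa u + a) + B (Ya u - b), A (Xa u + a))"
        using decomp[OF u] a b by (simp add: p A B)
      then show "p \<in> rel_projection M N" unfolding rel_projection_def assms by blast
    qed
  qed
  show ?thesis
    unfolding is_direct_sum_def using lin_L lin_MN disjoint sum by blast
qed

end
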